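(* Let $G$ be a group with a finite generating set $X$, and let $g\in G$. Let $(\Omega,\mathcal{F},\mathbf{P})$ be a probability space and $\xi:\Omega\to G$ a $G$-valued random element whose weight function $M_\xi$ is totally defined. Then for the random element $\xi_g$ defined by $\xi_g(\omega)=g\xi(\omega)$ we have $$\mathbb{E}(\xi_g)=g\,\mathbb{E}(\xi).$$
   Context: $d=d_X$ is the word metric on $G$ coming from the Cayley graph of $G$ with respect to $X$, i.e. $d_X(a,b)$ is the least length of a word in $X^{\pm1}$ representing $a^{-1}b$. A $G$-valued random element is a measurable function $\xi:\Omega\to G$ ($G$ discrete), with distribution $\mu_\xi(h)=\mathbf{P}(\xi=h)$. Its weight function is $M_\xi(h)=\sum_{i\in G}d^2(h,i)\mu_\xi(i)$, totally defined if finite for every $h\in G$. Its mean-set is $\mathbb{E}(\xi)=\{h\in G\mid M_\xi(h)\le M_\xi(f)\ \forall f\in G\}$. For $A\subseteq G$, $gA=\{ga\mid a\in A\}$. *)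

theory Defs
  imports "HOL-Probability.Probability" "HOL-Algebra.Generated_Groups"
begin

text \<open>
  The distance is only meaningful when \<open>X\<close> generates \<open>G\<close>: otherwise the set of word
  lengths may be empty and \<open>LEAST\<close> returns an unspecified number.
\<close>

definition word_metric :: "('a, 'c) monoid_scheme \<Rightarrow> 'a set \<Rightarrow> 'a \<Rightarrow> 'a \<Rightarrow> nat" where
  "word_metric G X a b =
    (LEAST n. \<exists>w. length w = n \<and> set w \<subseteq> X \<union> m_inv G ` X \<and>
       foldr (\<otimes>\<^bsub>G\<^esub>) w \<one>\<^bsub>G\<^esub> = inv\<^bsub>G\<^esub> a \<otimes>\<^bsub>G\<^esub> b)"

definition random_element :: "('a, 'c) monoid_scheme \<Rightarrow> 'w measure \<Rightarrow> ('w \<Rightarrow> 'a) \<Rightarrow> bool" where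
  "random_element G P \<xi> \<longleftrightarrow> \<xi> \<in> measurable P (count_space (carrier G))"

definition distribution :: "'w measure \<Rightarrow> ('w \<Rightarrow> 'a) \<Rightarrow> 'a \<Rightarrow> real" where
  "distribution P \<xi> h = \<P>(\<omega> in P. \<xi> \<omega> = h)"

text \<open>
  The weight function is \<open>ennreal\<close>-valued, so that a divergent series of nonnegative terms
  has the value \<open>\<infinity>\<close> (and not the default value \<open>0\<close> of a real-valued infinite sum).
\<close>

definition weight_function ::
    "('a, 'c) monoid_scheme \<Rightarrow> 'a set \<Rightarrow> 'w measure \<Rightarrow> ('w \<Rightarrow> 'a) \<Rightarrow> 'a \<Rightarrow> ennreal" where
  "weight_function G X P \<xi> h =
    (\<Sum>\<^sub>\<infinity>i\<in>carrier G. ennreal ((real (word_metric G X h i))\<^sup>2 * distribution P \<xi> i))"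

definition totally_defined ::
    "('a, 'c) monoid_scheme \<Rightarrow> 'a set \<Rightarrow> 'w measure \<Rightarrow> ('w \<Rightarrow> 'a) \<Rightarrow> bool" where
  "totally_defined G X P \<xi> \<longleftrightarrow> (\<forall>h\<in>carrier G. weight_function G X P \<xi> h < \<infinity>)"

definition mean_set ::
    "('a, 'c) monoid_scheme \<Rightarrow> 'a set \<Rightarrow> 'w measure \<Rightarrow> ('w \<Rightarrow> 'a) \<Rightarrow> 'a set" where
  "mean_set G X P \<xi> =
    {h \<in> carrier G. \<forall>f\<in>carrier G. weight_function G X P \<xi> h \<le> weight_function G X P \<xi> f}"

end

theory Submission
  imports Defs
begin

text \<open>
  Left multiplication by \<open>g\<close> is an isometry of the Cayley graph, because the distance of \<open>a\<close> and
  \<open>b\<close> depends only on \<open>a\<inverse>b\<close>, which does not change when both points are multiplied by \<open>g\<close>. It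
  also carries the distribution of \<open>\<xi>\<close> to that of \<open>g\<xi>\<close>. So the weight of \<open>gh\<close> for \<open>g\<xi>\<close> is the
  weight of \<open>h\<close> for \<open>\<xi>\<close>: substitute \<open>i = gj\<close> in the defining series
  (\<open>weight_function_translate\<close>). The translation is a bijection of \<open>G\<close>, hence it carries the
  minimizers of one weight function exactly onto those of the other.
\<close>

lemma (in group) word_metric_left_invariant:
  assumes "g \<in> carrier G" "a \<in> carrier G" "b \<in> carrier G"
  shows "word_metric G X (g \<otimes> a) (g \<otimes> b) = word_metric G X a b"
proof -
  have "inv (g \<otimes> a) \<otimes> (g \<otimes> b) = inv a \<otimes> (inv g \<otimes> (g \<otimes> b))"
    using assms by (simp add: inv_mult_group m_assoc)
  also have "\<dots> = inv a \<otimes> b"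
    using assms by (simp flip: m_assoc)
  finally show ?thesis
    by (simp add: word_metric_def)
qed

lemma (in group) distribution_translate:
  assumes "random_element G P \<xi>" "g \<in> carrier G" "i \<in> carrier G"
  shows "distribution P (\<lambda>\<omega>. g \<otimes> \<xi> \<omega>) (g \<otimes> i) = distribution P \<xi> i"
proof -
  have "\<xi> \<omega> \<in> carrier G" if "\<omega> \<in> space P" for \<omega>
    using measurable_space[OF assms(1)[unfolded random_element_def] that] by simp
  then have "{\<omega> \<in> space P. g \<otimes> \<xi> \<omega> = g \<otimes> i} = {\<omega> \<in> space P. \<xi> \<omega> = i}"
    using assms by auto
  then show ?thesis
    by (simp add: distribution_def)
qed

lemma (in group) bij_betw_left_translation:
  assumes "g \<in> carrier G"
  shows "bij_betw ((\<otimes>) g) (carrier G) (carrier G)"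
  using assms by (simp add: bij_betw_def inj_on_cmult surj_const_mult)

lemma (in group) weight_function_translate:
  assumes "random_element G P \<xi>" "g \<in> carrier G" "h \<in> carrier G"
  shows "weight_function G X P (\<lambda>\<omega>. g \<otimes> \<xi> \<omega>) (g \<otimes> h) = weight_function G X P \<xi> h"
proof -
  let ?t = "\<lambda>i. ennreal ((real (word_metric G X (g \<otimes> h) i))\<^sup>2 * distribution P (\<lambda>\<omega>. g \<otimes> \<xi> \<omega>) i)"
  have "weight_function G X P (\<lambda>\<omega>. g \<otimes> \<xi> \<omega>) (g \<otimes> h) = (\<Sum>\<^sub>\<infinity>j\<in>carrier G. ?t (g \<otimes> j))"
    unfolding weight_function_def
    by (rule infsum_reindex_bij_betw[OF bij_betw_left_translation[OF assms(2)], symmetric])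
  also have "\<dots> = weight_function G X P \<xi> h"
    unfolding weight_function_def using assms
    by (intro infsum_cong) (simp add: word_metric_left_invariant distribution_translate)
  finally show ?thesis .
qed

theorem proposition2p5:
  fixes G :: "('a, 'c) monoid_scheme" and X :: "'a set" and g :: 'a
    and P :: "'w measure" and \<xi> :: "'w \<Rightarrow> 'a"
  assumes "group G"
    and "finite X" and "X \<subseteq> carrier G" and "generate G X = carrier G"
    and "g \<in> carrier G"
    and "prob_space P"
    and "random_element G P \<xi>"
    and "totally_defined G X P \<xi>"
  shows "mean_set G X P (\<lambda>\<omega>. g \<otimes>\<^bsub>G\<^esub> \<xi> \<omega>) = g <#\<^bsub>G\<^esub> mean_set G X P \<xi>"
proof -
  interpret group G by fact
  let ?W = "weight_function G X P (\<lambda>\<omega>. g \<otimes>\<^bsub>G\<^esub> \<xi> \<omega>)"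
  let ?M = "mean_set G X P (\<lambda>\<omega>. g \<otimes>\<^bsub>G\<^esub> \<xi> \<omega>)"
  have carrier_translate: "carrier G = (\<otimes>\<^bsub>G\<^esub>) g ` carrier G"
    using surj_const_mult[OF \<open>g \<in> carrier G\<close>] by simp
  have min_iff: "g \<otimes>\<^bsub>G\<^esub> h \<in> ?M \<longleftrightarrow> h \<in> mean_set G X P \<xi>" if "h \<in> carrier G" for h
  proof -
    have "(\<forall>f\<in>carrier G. ?W (g \<otimes>\<^bsub>G\<^esub> h) \<le> ?W f)
      \<longleftrightarrow> (\<forall>f\<in>carrier G. ?W (g \<otimes>\<^bsub>G\<^esub> h) \<le> ?W (g \<otimes>\<^bsub>G\<^esub> f))"
      by (subst carrier_translate) simp
    then show ?thesis
      using that assms by (simp add: mean_set_def weight_function_translate)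
  qed
  have "?M \<subseteq> (\<otimes>\<^bsub>G\<^esub>) g ` carrier G"
    using carrier_translate by (auto simp: mean_set_def)
  moreover have "mean_set G X P \<xi> \<subseteq> carrier G"
    by (auto simp: mean_set_def)
  ultimately have "?M = (\<otimes>\<^bsub>G\<^esub>) g ` mean_set G X P \<xi>"
    using min_iff by blast
  then show ?thesis
    by (auto simp: l_coset_def)
qed

end
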